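(* Let $q$ be a power of a prime $p$. The group $\mathrm{PGO}_n^\bullet(q)$ has a mixed identity of length eight when $p\neq 2$.
   Context: $\mathrm{GO}_n^\bullet(q)$ is the isometry group of a nondegenerate symmetric bilinear form (equivalently, for $p\ne2$, a nonsingular quadratic form) on $V=\mathbb F_q^n$, and $\mathrm{PGO}_n^\bullet(q)$ is its quotient by the scalars it contains; $\bullet$ denotes the type of the form ($+$, $-$, or none). For a group $G$, let $\mathbf F_r$ be the free group on $x_1,\dots,x_r$. Every $w\in G*\mathbf F_r$ has a reduced form $w=c_0x_{i(1)}^{\varepsilon(1)}c_1\cdots c_{l-1}x_{i(l)}^{\varepsilon(l)}c_l$ with $c_j\in G$, $\varepsilon(j)\in\{\pm1\}$, where $c_j\ne 1$ whenever $i(j)=i(j+1)$ and $\varepsilon(j)=-\varepsilon(j+1)$ ($1\le j\le l-1$); its length is $l$. The word $w$ is a mixed identity for $G$ (with constants in $G$) if $w\neq1$ in $G*\mathbf F_r$ and $w(g_1,\dots,g_r)=1$ for all $(g_1,\dots,g_r)\in G^r$.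
   Formalization: The cases n = 3 and n = 4 with form of type − are excluded: there the claim fails for large q (for n = 3, PGO_3(q) ≅ PGL_2(q) has no mixed identity of length eight once q ≥ 23); all other n and types are covered. *)

theory Defs
  imports "HOL-Analysis.Cartesian_Space" "HOL-Algebra.Coset"
    "HOL-Computational_Algebra.Primes" "HOL-Library.FuncSet"
begin

section \<open>Orthogonal groups\<close>

definition symmetric_bilinear_form ::
    "('a::field ^ 'n \<Rightarrow> 'a ^ 'n \<Rightarrow> 'a) \<Rightarrow> bool" where
  "symmetric_bilinear_form B \<longleftrightarrow>
     (\<forall>x. Vector_Spaces.linear (*s) (*) (B x)) \<and> (\<forall>x y. B x y = B y x)"

definition nondegenerate_form ::
    "('a::field ^ 'n \<Rightarrow> 'a ^ 'n \<Rightarrow> 'a) \<Rightarrow> bool" where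
  "nondegenerate_form B \<longleftrightarrow> (\<forall>x. (\<forall>y. B x y = 0) \<longrightarrow> x = 0)"

definition GO ::
    "('a::field ^ 'n \<Rightarrow> 'a ^ 'n \<Rightarrow> 'a) \<Rightarrow> ('a ^ 'n \<Rightarrow> 'a ^ 'n) monoid" where
  "GO B = \<lparr>carrier = {g. Vector_Spaces.linear (*s) (*s) g \<and> bij g \<and>
                         (\<forall>x y. B (g x) (g y) = B x y)},
           monoid.mult = (\<circ>), one = id\<rparr>"

definition GO_scalars ::
    "('a::field ^ 'n \<Rightarrow> 'a ^ 'n \<Rightarrow> 'a) \<Rightarrow> ('a ^ 'n \<Rightarrow> 'a ^ 'n) set" where
  "GO_scalars B = carrier (GO B) \<inter> range (\<lambda>c. (*s) c)"

definition PGO ::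
    "('a::field ^ 'n \<Rightarrow> 'a ^ 'n \<Rightarrow> 'a) \<Rightarrow> ('a ^ 'n \<Rightarrow> 'a ^ 'n) set monoid" where
  "PGO B = GO B Mod GO_scalars B"

definition totally_singular ::
    "('a::field ^ 'n \<Rightarrow> 'a ^ 'n \<Rightarrow> 'a) \<Rightarrow> ('a ^ 'n) set \<Rightarrow> bool" where
  "totally_singular B W \<longleftrightarrow> vec.subspace W \<and> (\<forall>x\<in>W. \<forall>y\<in>W. B x y = 0)"

definition witt_index :: "('a::field ^ 'n \<Rightarrow> 'a ^ 'n \<Rightarrow> 'a) \<Rightarrow> nat" where
  "witt_index B = Max {vec.dim W | W. totally_singular B W}"

text \<open>Over a finite field of odd order, a nondegenerate form in even dimension \<open>2m\<close> has Witt
  index \<open>m\<close> (type \<open>+\<close>) or \<open>m - 1\<close> (type \<open>-\<close>).\<close>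

definition minus_type :: "('a::field ^ 'n \<Rightarrow> 'a ^ 'n \<Rightarrow> 'a) \<Rightarrow> bool" where
  "minus_type B \<longleftrightarrow> CARD('n) = 2 * (witt_index B + 1)"


section \<open>Words with constants\<close>

text \<open>The pair \<open>(c\<^sub>0, [(i\<^sub>1, e\<^sub>1, c\<^sub>1), \<dots>, (i\<^sub>l, e\<^sub>l, c\<^sub>l)])\<close> stands for
  \<open>c\<^sub>0 x\<^bsub>i\<^sub>1\<^esub>\<^bsup>e\<^sub>1\<^esup> c\<^sub>1 \<dots> x\<^bsub>i\<^sub>l\<^esub>\<^bsup>e\<^sub>l\<^esup> c\<^sub>l\<close>. The reduced ones are a system of normal forms for
  \<open>G * F\<^sub>r\<close>, and the free product is modelled as the set of these normal forms, with
  concatenation followed by reduction as multiplication.\<close>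

type_synonym 'g mword = "'g \<times> (nat \<times> int \<times> 'g) list"

definition reduced :: "('g, 'm) monoid_scheme \<Rightarrow> nat \<Rightarrow> 'g mword \<Rightarrow> bool" where
  "reduced G r w \<longleftrightarrow>
     fst w \<in> carrier G \<and>
     (\<forall>(i, e, c) \<in> set (snd w). i \<in> {1..r} \<and> e \<in> {1, -1} \<and> c \<in> carrier G) \<and>
     successively (\<lambda>(i, e, c) (i', e', c'). i = i' \<and> e = - e' \<longrightarrow> c \<noteq> \<one>\<^bsub>G\<^esub>) (snd w)"

definition const_times :: "('g, 'm) monoid_scheme \<Rightarrow> 'g \<Rightarrow> 'g mword \<Rightarrow> 'g mword" where
  "const_times G c w = (c \<otimes>\<^bsub>G\<^esub> fst w, snd w)"

fun letter_times :: "('g, 'm) monoid_scheme \<Rightarrow> nat \<Rightarrow> int \<Rightarrow> 'g mword \<Rightarrow> 'g mword" where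
  "letter_times G i e (c, []) = (\<one>\<^bsub>G\<^esub>, [(i, e, c)])"
| "letter_times G i e (c, (i', e', c') # ls) =
     (if i = i' \<and> e = - e' \<and> c = \<one>\<^bsub>G\<^esub> then (c', ls)
      else (\<one>\<^bsub>G\<^esub>, (i, e, c) # (i', e', c') # ls))"

definition letters_times ::
    "('g, 'm) monoid_scheme \<Rightarrow> (nat \<times> int \<times> 'g) list \<Rightarrow> 'g mword \<Rightarrow> 'g mword" where
  "letters_times G ls w =
     foldr (\<lambda>(i, e, c) v. letter_times G i e (const_times G c v)) ls w"

definition free_prod :: "('g, 'm) monoid_scheme \<Rightarrow> nat \<Rightarrow> 'g mword monoid" where
  "free_prod G r =
     \<lparr>carrier = {w. reduced G r w},
      monoid.mult = (\<lambda>u w. const_times G (fst u) (letters_times G (snd u) w)),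
      one = (\<one>\<^bsub>G\<^esub>, [])\<rparr>"

definition word_length :: "'g mword \<Rightarrow> nat" where
  "word_length w = length (snd w)"

definition word_eval :: "('g, 'm) monoid_scheme \<Rightarrow> (nat \<Rightarrow> 'g) \<Rightarrow> 'g mword \<Rightarrow> 'g" where
  "word_eval G g w =
     fst w \<otimes>\<^bsub>G\<^esub> foldr (\<lambda>(i, e, c) z. (g i [^]\<^bsub>G\<^esub> e) \<otimes>\<^bsub>G\<^esub> (c \<otimes>\<^bsub>G\<^esub> z)) (snd w) \<one>\<^bsub>G\<^esub>"

definition mixed_identity :: "('g, 'm) monoid_scheme \<Rightarrow> nat \<Rightarrow> 'g mword \<Rightarrow> bool" where
  "mixed_identity G r w \<longleftrightarrow>
     w \<in> carrier (free_prod G r) \<and> w \<noteq> \<one>\<^bsub>free_prod G r\<^esub> \<and>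
     (\<forall>g \<in> {1..r} \<rightarrow>\<^sub>E carrier G. word_eval G g w = \<one>\<^bsub>G\<^esub>)"


subsection \<open>The free product is a group, and evaluation is a homomorphism\<close>

context group
begin

lemma const_times_reduced:
  "reduced G r w \<Longrightarrow> c \<in> carrier G \<Longrightarrow> reduced G r (const_times G c w)"
  by (auto simp: reduced_def const_times_def)

lemma letter_times_reduced:
  assumes "reduced G r w" "i \<in> {1..r}" "e \<in> {1, -1}"
  shows "reduced G r (letter_times G i e w)"
proof -
  obtain c ls where w: "w = (c, ls)" by (cases w)
  show ?thesis
  proof (cases ls)
    case Nil
    then show ?thesis using assms w by (auto simp: reduced_def)
  next
    case (Cons l ls')
    obtain i' e' c' where l: "l = (i', e', c')" by (cases l)
    show ?thesis using assms unfolding w Cons l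
      by (auto simp: reduced_def successively_Cons)
  qed
qed

lemma letter_times_cancel:
  assumes "reduced G r w" "e \<in> {1, -1}"
  shows "letter_times G i e (letter_times G i (- e) w) = w"
proof -
  obtain c ls where w: "w = (c, ls)" by (cases w)
  show ?thesis
  proof (cases ls)
    case Nil
    then show ?thesis using w by simp
  next
    case (Cons l ls')
    obtain i' e' c' where l: "l = (i', e', c')" by (cases l)
    show ?thesis
    proof (cases ls')
      case Nil
      then show ?thesis using assms unfolding w Cons l by auto
    next
      case (Cons l2 ls2)
      obtain i2 e2 c2 where "l2 = (i2, e2, c2)" by (cases l2)
      then show ?thesis using assms unfolding w \<open>ls = l # ls'\<close> l Cons
        by (auto simp: reduced_def)
    qed
  qed
qed

lemma reduced_tail: "reduced G r (c, (i, e, d) # ls) \<Longrightarrow> reduced G r (d, ls)"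
  by (auto simp: reduced_def successively_Cons)

lemma reduced_fst: "reduced G r w \<Longrightarrow> fst w \<in> carrier G"
  by (simp add: reduced_def)

lemma letters_times_reduced:
  assumes "reduced G r (c, ls)" "reduced G r w"
  shows "reduced G r (letters_times G ls w)"
  using assms
proof (induction ls arbitrary: c)
  case Nil
  then show ?case by (simp add: letters_times_def)
next
  case (Cons l ls)
  obtain i e d where l: "l = (i, e, d)" by (cases l)
  have "reduced G r (letters_times G ls w)"
    using Cons.IH Cons.prems reduced_tail unfolding l by blast
  moreover have "i \<in> {1..r}" "e \<in> {1, -1}" "d \<in> carrier G"
    using Cons.prems unfolding l reduced_def by auto
  ultimately show ?case
    using letter_times_reduced const_times_reduced unfolding l letters_times_def by simp
qed

lemma free_prod_mult_reduced:
  assumes "reduced G r u" "reduced G r w"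
  shows "reduced G r (u \<otimes>\<^bsub>free_prod G r\<^esub> w)"
  using assms letters_times_reduced[of r "fst u" "snd u" w] const_times_reduced reduced_fst
  by (simp add: free_prod_def)

lemma const_times_const_times:
  assumes "a \<in> carrier G" "b \<in> carrier G" "reduced G r w"
  shows "const_times G a (const_times G b w) = const_times G (a \<otimes> b) w"
  using assms by (auto simp: const_times_def reduced_def m_assoc)

lemma const_times_one: "reduced G r w \<Longrightarrow> const_times G \<one> w = w"
  by (auto simp: const_times_def reduced_def)

lemma mult_const_times:
  assumes "a \<in> carrier G" "reduced G r v" "reduced G r w"
  shows "const_times G a v \<otimes>\<^bsub>free_prod G r\<^esub> w = const_times G a (v \<otimes>\<^bsub>free_prod G r\<^esub> w)"
  using assms reduced_fst[OF letters_times_reduced[of r "fst v" "snd v" w]] reduced_fst[of r v]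
  by (simp add: free_prod_def const_times_def m_assoc)

lemma mult_letter_times:
  assumes "reduced G r v" "reduced G r w" "i \<in> {1..r}" "e \<in> {1, -1}"
  shows "letter_times G i e v \<otimes>\<^bsub>free_prod G r\<^esub> w = letter_times G i e (v \<otimes>\<^bsub>free_prod G r\<^esub> w)"
proof -
  obtain c ls where v: "v = (c, ls)" by (cases v)
  let ?L = "\<lambda>ls. letters_times G ls w"
  have L: "reduced G r (?L ls)" using letters_times_reduced assms v by blast
  have c: "c \<in> carrier G" using assms v by (auto simp: reduced_def)
  have LC: "?L ((j, f, d) # ls') = letter_times G j f (const_times G d (?L ls'))" for j f d ls'
    by (simp add: letters_times_def)
  have one: "const_times G \<one> (letter_times G i e (const_times G c (?L ls))) =
      letter_times G i e (const_times G c (?L ls))"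
    using assms L c by (intro const_times_one letter_times_reduced const_times_reduced)
  show ?thesis
  proof (cases "\<exists>c' ls'. ls = (i, - e, c') # ls' \<and> c = \<one>")
    case False
    then have "letter_times G i e v = (\<one>, (i, e, c) # ls)"
      unfolding v by (cases ls) auto
    then show ?thesis using one by (simp add: free_prod_def LC v)
  next
    case True
    then obtain c' ls' where ls: "ls = (i, - e, c') # ls'" and c1: "c = \<one>" by blast
    have r': "reduced G r (c', ls')" using assms(1) reduced_tail unfolding v ls by blast
    then have r2: "reduced G r (const_times G c' (?L ls'))"
      using letters_times_reduced[OF r' assms(2)] const_times_reduced reduced_fst[OF r'] by simp
    have "const_times G c (?L ls) = ?L ls" using const_times_one[OF L] c1 by simp
    then show ?thesis
      using letter_times_cancel[OF r2 assms(4)]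
      by (simp add: v ls c1 free_prod_def LC)
  qed
qed

lemma free_prod_assoc:
  assumes "reduced G r u" "reduced G r v" "reduced G r w"
  shows "(u \<otimes>\<^bsub>free_prod G r\<^esub> v) \<otimes>\<^bsub>free_prod G r\<^esub> w = u \<otimes>\<^bsub>free_prod G r\<^esub> (v \<otimes>\<^bsub>free_prod G r\<^esub> w)"
proof -
  have *: "letters_times G ls v \<otimes>\<^bsub>free_prod G r\<^esub> w = letters_times G ls (v \<otimes>\<^bsub>free_prod G r\<^esub> w)"
    if "reduced G r (c, ls)" for c ls
    using that
  proof (induction ls arbitrary: c)
    case Nil
    then show ?case by (simp add: letters_times_def)
  next
    case (Cons l ls)
    obtain i e d where l: "l = (i, e, d)" by (cases l)
    have r': "reduced G r (d, ls)" using Cons.prems reduced_tail unfolding l by blast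
    have ied: "i \<in> {1..r}" "e \<in> {1, -1}" "d \<in> carrier G"
      using Cons.prems unfolding l reduced_def by auto
    have rl: "reduced G r (letters_times G ls v)"
      using letters_times_reduced[OF r' assms(2)] .
    have "letters_times G (l # ls) v \<otimes>\<^bsub>free_prod G r\<^esub> w
        = letter_times G i e (const_times G d (letters_times G ls v)) \<otimes>\<^bsub>free_prod G r\<^esub> w"
      by (simp add: letters_times_def l)
    also have "\<dots> = letter_times G i e (const_times G d (letters_times G ls v \<otimes>\<^bsub>free_prod G r\<^esub> w))"
      using mult_letter_times[OF const_times_reduced[OF rl ied(3)] assms(3) ied(1,2)]
        mult_const_times[OF ied(3) rl assms(3)] by simp
    also have "\<dots> = letters_times G (l # ls) (v \<otimes>\<^bsub>free_prod G r\<^esub> w)"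
      using Cons.IH[OF r'] by (simp add: letters_times_def l)
    finally show ?case .
  qed
  have u: "reduced G r (fst u, snd u)" "fst u \<in> carrier G"
    using assms(1) by (auto simp: reduced_def)
  have "(u \<otimes>\<^bsub>free_prod G r\<^esub> v) \<otimes>\<^bsub>free_prod G r\<^esub> w
      = const_times G (fst u) (letters_times G (snd u) v) \<otimes>\<^bsub>free_prod G r\<^esub> w"
    by (simp add: free_prod_def)
  also have "\<dots> = const_times G (fst u) (letters_times G (snd u) v \<otimes>\<^bsub>free_prod G r\<^esub> w)"
    using mult_const_times[OF u(2) letters_times_reduced[OF u(1) assms(2)] assms(3)] .
  also have "\<dots> = u \<otimes>\<^bsub>free_prod G r\<^esub> (v \<otimes>\<^bsub>free_prod G r\<^esub> w)"
    using *[OF u(1)] by (simp add: free_prod_def)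
  finally show ?thesis .
qed

lemma free_prod_left_inv:
  assumes "reduced G r (c, ls)"
  shows "\<exists>v. reduced G r v \<and> v \<otimes>\<^bsub>free_prod G r\<^esub> (c, ls) = (\<one>, [])"
  using assms
proof (induction ls arbitrary: c)
  case Nil
  then have "c \<in> carrier G" by (auto simp: reduced_def)
  then show ?case
    by (intro exI[of _ "(inv c, [])"])
       (auto simp: reduced_def free_prod_def const_times_def letters_times_def)
next
  case (Cons l ls)
  obtain i e d where l: "l = (i, e, d)" by (cases l)
  have r': "reduced G r (d, ls)" using Cons.prems reduced_tail unfolding l by blast
  have ied: "i \<in> {1..r}" "e \<in> {1, -1}" "d \<in> carrier G" "c \<in> carrier G"
    using Cons.prems unfolding l reduced_def by auto
  obtain v where v: "reduced G r v" "v \<otimes>\<^bsub>free_prod G r\<^esub> (d, ls) = (\<one>, [])"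
    using Cons.IH[OF r'] by blast
  define x :: "'a mword" where "x = (\<one>, [(i, - e, inv c)])"
  have x: "reduced G r x" using ied by (auto simp: x_def reduced_def)
  have xe: "x \<otimes>\<^bsub>free_prod G r\<^esub> (c, l # ls) = (d, ls)"
    using ied by (simp add: x_def l free_prod_def letters_times_def const_times_def)
  have "(v \<otimes>\<^bsub>free_prod G r\<^esub> x) \<otimes>\<^bsub>free_prod G r\<^esub> (c, l # ls) = (\<one>, [])"
    using free_prod_assoc[OF v(1) x Cons.prems] xe v(2) by simp
  then show ?case using free_prod_mult_reduced[OF v(1) x] by blast
qed

theorem group_free_prod: "group (free_prod G r)"
proof (rule groupI)
  fix x y z assume xyz: "x \<in> carrier (free_prod G r)" "y \<in> carrier (free_prod G r)"
    "z \<in> carrier (free_prod G r)"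
  then show "x \<otimes>\<^bsub>free_prod G r\<^esub> y \<otimes>\<^bsub>free_prod G r\<^esub> z = x \<otimes>\<^bsub>free_prod G r\<^esub> (y \<otimes>\<^bsub>free_prod G r\<^esub> z)"
    using free_prod_assoc[of r x y z] by (simp add: free_prod_def)
next
  fix x y assume "x \<in> carrier (free_prod G r)" "y \<in> carrier (free_prod G r)"
  then show "x \<otimes>\<^bsub>free_prod G r\<^esub> y \<in> carrier (free_prod G r)"
    using free_prod_mult_reduced[of r x y] by (simp add: free_prod_def)
next
  show "\<one>\<^bsub>free_prod G r\<^esub> \<in> carrier (free_prod G r)"
    by (simp add: free_prod_def reduced_def)
next
  fix x assume "x \<in> carrier (free_prod G r)"
  then show "\<one>\<^bsub>free_prod G r\<^esub> \<otimes>\<^bsub>free_prod G r\<^esub> x = x"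
    using const_times_one[of r x] by (simp add: free_prod_def letters_times_def)
next
  fix x assume "x \<in> carrier (free_prod G r)"
  then show "\<exists>y\<in>carrier (free_prod G r). y \<otimes>\<^bsub>free_prod G r\<^esub> x = \<one>\<^bsub>free_prod G r\<^esub>"
    using free_prod_left_inv[of r "fst x" "snd x"] by (auto simp: free_prod_def)
qed

lemma letters_eval_closed:
  assumes "reduced G r (c, ls)" "g \<in> {1..r} \<rightarrow> carrier G"
  shows "foldr (\<lambda>(i, e, c) z. (g i [^] e) \<otimes> (c \<otimes> z)) ls \<one> \<in> carrier G"
  using assms
proof (induction ls arbitrary: c)
  case Nil
  then show ?case by simp
next
  case (Cons l ls)
  obtain i e d where l: "l = (i, e, d)" by (cases l)
  have "i \<in> {1..r}" "d \<in> carrier G"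
    using Cons.prems unfolding l reduced_def by auto
  then show ?case
    using Cons.IH[OF reduced_tail[OF Cons.prems(1)[unfolded l]]] Cons.prems(2)
    by (auto simp: l Pi_iff intro!: m_closed int_pow_closed)
qed

lemma word_eval_closed:
  "reduced G r w \<Longrightarrow> g \<in> {1..r} \<rightarrow> carrier G \<Longrightarrow> word_eval G g w \<in> carrier G"
  using letters_eval_closed[of r "fst w" "snd w" g] reduced_fst[of r w]
  by (simp add: word_eval_def)

lemma word_eval_const_times:
  assumes "reduced G r w" "g \<in> {1..r} \<rightarrow> carrier G" "a \<in> carrier G"
  shows "word_eval G g (const_times G a w) = a \<otimes> word_eval G g w"
  using assms letters_eval_closed[of r "fst w" "snd w" g] reduced_fst[of r w]
  by (simp add: word_eval_def const_times_def m_assoc)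

lemma word_eval_letter_times:
  assumes "reduced G r w" "g \<in> {1..r} \<rightarrow> carrier G" "i \<in> {1..r}" "e \<in> {1, -1}"
  shows "word_eval G g (letter_times G i e w) = (g i [^] e) \<otimes> word_eval G g w"
proof -
  obtain c ls where w: "w = (c, ls)" by (cases w)
  have c: "c \<in> carrier G" using assms w by (auto simp: reduced_def)
  have gi: "g i \<in> carrier G" using assms by auto
  let ?E = "\<lambda>ls. foldr (\<lambda>(i, e, c) z. (g i [^] e) \<otimes> (c \<otimes> z)) ls \<one>"
  have E: "?E ls \<in> carrier G" using letters_eval_closed assms w by blast
  show ?thesis
  proof (cases "\<exists>c' ls'. ls = (i, - e, c') # ls' \<and> c = \<one>")
    case False
    then have "letter_times G i e w = (\<one>, (i, e, c) # ls)"
      unfolding w by (cases ls) auto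
    then show ?thesis using c gi E by (simp add: word_eval_def w)
  next
    case True
    then obtain c' ls' where ls: "ls = (i, - e, c') # ls'" and c1: "c = \<one>" by blast
    have r': "reduced G r (c', ls')" using assms(1) reduced_tail unfolding w ls by blast
    have E': "?E ls' \<in> carrier G" using letters_eval_closed[OF r' assms(2)] .
    have c': "c' \<in> carrier G" using r' by (auto simp: reduced_def)
    have "(g i [^] e) \<otimes> ((g i [^] (- e)) \<otimes> (c' \<otimes> ?E ls')) = c' \<otimes> ?E ls'"
      using gi c' E' by (simp add: m_assoc[symmetric] int_pow_neg)
    then show ?thesis using gi c' E' by (simp add: word_eval_def w ls c1)
  qed
qed

theorem word_eval_hom:
  assumes "g \<in> {1..r} \<rightarrow> carrier G"
  shows "word_eval G g \<in> hom (free_prod G r) G"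
    and "c \<in> carrier G \<Longrightarrow> word_eval G g (c, []) = c"
    and "i \<in> {1..r} \<Longrightarrow> word_eval G g (\<one>, [(i, 1, \<one>)]) = g i"
proof -
  have *: "word_eval G g (letters_times G ls w) =
      foldr (\<lambda>(i, e, c) z. (g i [^] e) \<otimes> (c \<otimes> z)) ls \<one> \<otimes> word_eval G g w"
    if "reduced G r (c, ls)" "reduced G r w" for c ls w
    using that
  proof (induction ls arbitrary: c)
    case Nil
    then show ?case using word_eval_closed assms by (simp add: letters_times_def)
  next
    case (Cons l ls)
    obtain i e d where l: "l = (i, e, d)" by (cases l)
    have r': "reduced G r (d, ls)" using Cons.prems reduced_tail unfolding l by blast
    have ied: "i \<in> {1..r}" "e \<in> {1, -1}" "d \<in> carrier G" "g i \<in> carrier G"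
      using Cons.prems assms unfolding l reduced_def by auto
    have rl: "reduced G r (letters_times G ls w)"
      using letters_times_reduced[OF r' Cons.prems(2)] .
    have "word_eval G g (letters_times G (l # ls) w) =
        (g i [^] e) \<otimes> (d \<otimes> word_eval G g (letters_times G ls w))"
      using word_eval_letter_times[OF const_times_reduced[OF rl ied(3)] assms ied(1,2)]
        word_eval_const_times[OF rl assms ied(3)] by (simp add: letters_times_def l)
    then show ?case
      using Cons.IH[OF r' Cons.prems(2)] letters_eval_closed[OF r' assms] ied
        word_eval_closed[OF Cons.prems(2) assms]
      by (simp add: l m_assoc)
  qed
  show "word_eval G g \<in> hom (free_prod G r) G"
  proof (rule homI)
    fix u assume "u \<in> carrier (free_prod G r)"
    then show "word_eval G g u \<in> carrier G"
      using word_eval_closed assms by (simp add: free_prod_def)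
  next
    fix u w assume "u \<in> carrier (free_prod G r)" "w \<in> carrier (free_prod G r)"
    then have r: "reduced G r (fst u, snd u)" "reduced G r w" by (auto simp: free_prod_def)
    have u: "fst u \<in> carrier G" using r by (auto simp: reduced_def)
    show "word_eval G g (u \<otimes>\<^bsub>free_prod G r\<^esub> w) = word_eval G g u \<otimes> word_eval G g w"
      using word_eval_const_times[OF letters_times_reduced[OF r] assms u] *[OF r]
        letters_eval_closed[OF r(1) assms] word_eval_closed[OF r(2) assms] u
      by (simp add: free_prod_def word_eval_def[of G g u] m_assoc)
  qed
  show "c \<in> carrier G \<Longrightarrow> word_eval G g (c, []) = c" by (simp add: word_eval_def)
  show "i \<in> {1..r} \<Longrightarrow> word_eval G g (\<one>, [(i, 1, \<one>)]) = g i"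
    using assms by (auto simp: word_eval_def Pi_iff)
qed

end

end

theory Submission
  imports Defs "HOL-Number_Theory.Residues"
begin

text \<open>Suppose that \<open>V\<close> contains a totally singular plane, spanned by \<open>u\<close> and \<open>v\<close>, and let \<open>t\<close> be
  the long root element \<open>x \<mapsto> x + B(x,u)v - B(x,v)u\<close>. Every conjugate of \<open>t\<close> is again of this
  form, and conjugating it by a reflection \<open>h\<close> yields an element which commutes with it: the plane
  and its image under \<open>h\<close> meet in the fixed vector \<open>B(v,z)u - B(u,z)v\<close>, where \<open>z\<close> is the
  centre of \<open>h\<close>. So \<open>x t x\<^sup>-\<^sup>1\<close> and \<open>h x t x\<^sup>-\<^sup>1 h\<^sup>-\<^sup>1\<close> commute for all \<open>x\<close>, and their commutator
  is a word of length eight with non-scalar constants. Over a finite field the plane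
  exists if \<open>n \<ge> 5\<close> or if \<open>n = 4\<close> and the type is plus. If \<open>n \<le> 2\<close>, squares are rotations or
  trivial, and the commutator of \<open>x\<^sup>2\<close> and \<open>y\<^sup>2\<close> is an identity.\<close>

section \<open>Two words of length eight\<close>

text \<open>The commutator of \<open>y = x t x^-1\<close> and \<open>h y h^-1\<close> written out,
  each constant being attached to the letter before it.\<close>

definition conj_comm_word :: "('g, 'm) monoid_scheme \<Rightarrow> 'g \<Rightarrow> 'g \<Rightarrow> 'g mword" where
  "conj_comm_word G t h = (\<one>\<^bsub>G\<^esub>,
     [(1, 1, t), (1, -1, h), (1, 1, t), (1, -1, inv\<^bsub>G\<^esub> h),
      (1, 1, inv\<^bsub>G\<^esub> t), (1, -1, h), (1, 1, inv\<^bsub>G\<^esub> t), (1, -1, inv\<^bsub>G\<^esub> h)])"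

text \<open>No nontrivial constant occurs: in dimension one the projective group is trivial and
  offers none.\<close>

definition square_comm_word :: "('g, 'm) monoid_scheme \<Rightarrow> 'g mword" where
  "square_comm_word G = (\<one>\<^bsub>G\<^esub>,
     [(1, 1, \<one>\<^bsub>G\<^esub>), (1, 1, \<one>\<^bsub>G\<^esub>), (2, 1, \<one>\<^bsub>G\<^esub>), (2, 1, \<one>\<^bsub>G\<^esub>),
      (1, -1, \<one>\<^bsub>G\<^esub>), (1, -1, \<one>\<^bsub>G\<^esub>), (2, -1, \<one>\<^bsub>G\<^esub>), (2, -1, \<one>\<^bsub>G\<^esub>)])"

context group
begin

lemma commutator_eq_one:
  assumes "a \<in> carrier G" "b \<in> carrier G" "a \<otimes> b = b \<otimes> a"
  shows "a \<otimes> b \<otimes> inv a \<otimes> inv b = \<one>"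
  using assms by (simp add: inv_solve_right m_assoc)

text \<open>The exponents of the single variable alternate, so nontriviality of \<open>t\<close> and
  \<open>h\<close> is exactly what makes the word reduced. Its value is a commutator, which vanishes
  by \<open>comm\<close>.\<close>

lemma mixed_identity_conj_comm_word:
  assumes t: "t \<in> carrier G" "t \<noteq> \<one>" and h: "h \<in> carrier G" "h \<noteq> \<one>"
    and comm: "\<And>x. x \<in> carrier G \<Longrightarrow>
      (x \<otimes> t \<otimes> inv x) \<otimes> (h \<otimes> (x \<otimes> t \<otimes> inv x) \<otimes> inv h) =
      (h \<otimes> (x \<otimes> t \<otimes> inv x) \<otimes> inv h) \<otimes> (x \<otimes> t \<otimes> inv x)"
  shows "mixed_identity G 1 (conj_comm_word G t h)"
  unfolding mixed_identity_def
proof (intro conjI ballI)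
  have "inv t \<noteq> \<one>" "inv h \<noteq> \<one>" using t h by (simp_all add: inv_eq_1_iff)
  then show "conj_comm_word G t h \<in> carrier (free_prod G 1)"
    using t h by (auto simp: conj_comm_word_def free_prod_def reduced_def)
  show "conj_comm_word G t h \<noteq> \<one>\<^bsub>free_prod G 1\<^esub>"
    by (simp add: conj_comm_word_def free_prod_def)
  fix g assume "g \<in> {1..1::nat} \<rightarrow>\<^sub>E carrier G"
  then have x: "g 1 \<in> carrier G" by auto
  define y where "y = g 1 \<otimes> t \<otimes> inv (g 1)"
  have y: "y \<in> carrier G" using x t by (simp add: y_def)
  have "word_eval G g (conj_comm_word G t h) =
      y \<otimes> (h \<otimes> y \<otimes> inv h) \<otimes> inv y \<otimes> inv (h \<otimes> y \<otimes> inv h)"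
    using x t h by (simp add: y_def word_eval_def conj_comm_word_def int_pow_neg m_assoc
        inv_mult_group)
  also have "\<dots> = \<one>"
    using commutator_eq_one[OF y _ comm[OF x, folded y_def]] y h by simp
  finally show "word_eval G g (conj_comm_word G t h) = \<one>" .
qed

lemma mixed_identity_square_comm_word:
  assumes comm: "\<And>x y. x \<in> carrier G \<Longrightarrow> y \<in> carrier G \<Longrightarrow>
      (x \<otimes> x) \<otimes> (y \<otimes> y) = (y \<otimes> y) \<otimes> (x \<otimes> x)"
  shows "mixed_identity G 2 (square_comm_word G)"
  unfolding mixed_identity_def
proof (intro conjI ballI)
  show "square_comm_word G \<in> carrier (free_prod G 2)"
    by (auto simp: square_comm_word_def free_prod_def reduced_def)
  show "square_comm_word G \<noteq> \<one>\<^bsub>free_prod G 2\<^esub>"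
    by (simp add: square_comm_word_def free_prod_def)
  fix g assume "g \<in> {1..2::nat} \<rightarrow>\<^sub>E carrier G"
  then have x: "g 1 \<in> carrier G" "g 2 \<in> carrier G" by auto
  have "word_eval G g (square_comm_word G) =
      (g 1 \<otimes> g 1) \<otimes> (g 2 \<otimes> g 2) \<otimes> inv (g 1 \<otimes> g 1) \<otimes> inv (g 2 \<otimes> g 2)"
    using x by (simp add: word_eval_def square_comm_word_def int_pow_neg m_assoc
        inv_mult_group)
  also have "\<dots> = \<one>"
    using commutator_eq_one[OF _ _ comm[OF x]] x by simp
  finally show "word_eval G g (square_comm_word G) = \<one>" .
qed

end

section \<open>Isotropic vectors over a finite field\<close>

lemma two_neq_zero_if_odd_card:
  assumes "odd CARD('a::{field, finite})"
  shows "(2::'a) \<noteq> 0"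
proof
  assume "(2::'a) = 0"
  then have "of_nat 2 = (0::'a)" by simp
  then have "CHAR('a) dvd 2" by (simp only: of_nat_eq_0_iff_char_dvd)
  then have "CHAR('a) = 1 \<or> CHAR('a) = 2"
    by (metis One_nat_def prime_nat_iff two_is_prime_nat)
  moreover have "CHAR('a) \<noteq> 1" by (metis of_nat_CHAR of_nat_1 zero_neq_one)
  ultimately show False using assms CHAR_dvd_CARD[where 'a='a] by simp
qed

text \<open>Both \<open>a x\<^sup>2\<close> and \<open>- c - b y\<^sup>2\<close> take more than half of all values.\<close>

lemma ex_scaled_squares_add_eq_zero:
  fixes a b c :: "'a::{field, finite}"
  assumes "odd CARD('a)" "a \<noteq> 0" "b \<noteq> 0"
  shows "\<exists>x y. a * x\<^sup>2 + b * y\<^sup>2 + c = 0"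
proof -
  let ?S = "range (\<lambda>x::'a. x\<^sup>2)"
  \<comment> \<open>Squaring is at most two-to-one, so there are at least
    \<open>CARD('a) / 2\<close> squares.\<close>
  have fibre: "card {x::'a. x\<^sup>2 = s} \<le> 2" for s
  proof (cases "\<exists>x::'a. x\<^sup>2 = s")
    case True
    then obtain x0 :: 'a where "x0\<^sup>2 = s" by blast
    then have "{x. x\<^sup>2 = s} \<subseteq> {x0, - x0}" by (auto simp: power2_eq_iff)
    then show ?thesis by (rule order.trans[OF card_mono[rotated]]) (auto simp: card_insert_if)
  qed simp
  have "(UNIV::'a set) = (\<Union>s\<in>?S. {x. x\<^sup>2 = s})" by auto
  then have "CARD('a) \<le> (\<Sum>s\<in>?S. card {x::'a. x\<^sup>2 = s})"
    by (metis card_UN_le finite)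
  also have "\<dots> \<le> (\<Sum>s\<in>?S. 2)" by (intro sum_mono fibre)
  finally have "CARD('a) \<le> 2 * card ?S" by simp
  \<comment> \<open>Parity makes the bound strict; two sets of this size must meet in the
    field.\<close>
  then have S: "CARD('a) < 2 * card ?S" using assms(1) by (metis even_mult_iff even_numeral
        order_less_le)
  let ?X = "(\<lambda>s. a * s) ` ?S" and ?Y = "(\<lambda>s. - c - b * s) ` ?S"
  have "card ?X = card ?S" "card ?Y = card ?S"
    using assms by (auto intro!: card_image simp: inj_on_def)
  then have "?X \<inter> ?Y \<noteq> {}"
    using S card_Un_disjoint[of ?X ?Y] card_mono[of "UNIV::'a set" "?X \<union> ?Y"] by auto
  then obtain x y where "a * x\<^sup>2 = - c - b * y\<^sup>2" by auto
  then have "a * x\<^sup>2 + b * y\<^sup>2 + c = 0" by (simp add: algebra_simps)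
  then show ?thesis by blast
qed

text \<open>If \<open>f w\<close> is nonzero for some \<open>w\<close> in \<open>S\<close>,
  subtracting a multiple of \<open>w\<close> moves any vector of \<open>S\<close> into the kernel,
  so \<open>w\<close> and the kernel span \<open>S\<close>.\<close>

lemma dim_Int_kernel:
  fixes f :: "'a::field ^ 'n \<Rightarrow> 'a"
  assumes f: "Vector_Spaces.linear (*s) (*) f" and S: "vec.subspace S"
  shows "vec.subspace (S \<inter> {x. f x = 0})" and "vec.dim S \<le> vec.dim (S \<inter> {x. f x = 0}) + 1"
proof -
  interpret f: Vector_Spaces.linear "(*s)" "(*)" f by fact
  let ?K = "S \<inter> {x. f x = 0}"
  show "vec.subspace ?K"
    using S f.subspace_kernel by (rule vec.subspace_inter)
  show "vec.dim S \<le> vec.dim ?K + 1"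
  proof (cases "\<exists>w\<in>S. f w \<noteq> 0")
    case False
    then have "?K = S" by auto
    then show ?thesis by simp
  next
    case True
    then obtain w where w: "w \<in> S" "f w \<noteq> 0" by blast
    have "x \<in> vec.span (insert w ?K)" if "x \<in> S" for x
    proof -
      have "x - (f x / f w) *s w \<in> ?K"
        using that w S by (simp add: f.diff f.scale vec.subspace_diff vec.subspace_scale)
      then have "(x - (f x / f w) *s w) + (f x / f w) *s w \<in> vec.span (insert w ?K)"
        by (intro vec.span_add vec.span_scale vec.span_base) auto
      then show ?thesis by simp
    qed
    then have "vec.dim S \<le> vec.dim (vec.span (insert w ?K))"
      by (intro vec.dim_subset) auto
    also have "\<dots> \<le> vec.dim ?K + 1"
      by (simp add: vec.dim_insert)
    finally show ?thesis .
  qed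
qed

lemma ex_nonzero_if_dim_pos:
  fixes S :: "('a::field ^ 'n) set"
  assumes "vec.dim S > 0"
  shows "\<exists>x\<in>S. x \<noteq> 0"
proof (rule ccontr)
  assume "\<not> ?thesis"
  then have "S \<subseteq> {0}" by blast
  then have "vec.dim S = 0" by simp
  then show False using assms by linarith
qed

section \<open>Orthogonal groups and their scalars\<close>

locale orthogonal_space =
  fixes B :: "'a::{field, finite} ^ 'n \<Rightarrow> 'a ^ 'n \<Rightarrow> 'a"
  assumes symmetric: "symmetric_bilinear_form B"
    and nondegenerate: "nondegenerate_form B"
    and odd_card: "odd CARD('a)"
begin

section \<open>Computing with the form, and isotropic vectors\<close>

lemma linear: "Vector_Spaces.linear (*s) (*) (B x)"
  using symmetric by (simp add: symmetric_bilinear_form_def)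

lemma commute: "B x y = B y x"
  using symmetric by (simp add: symmetric_bilinear_form_def)

lemma add_right: "B x (y + z) = B x y + B x z"
  and scale_right: "B x (c *s y) = c * B x y"
  and diff_right: "B x (y - z) = B x y - B x z"
  and zero_right: "B x 0 = 0"
proof -
  interpret Vector_Spaces.linear "(*s)" "(*)" "B x" by (rule linear)
  show "B x (y + z) = B x y + B x z" "B x (c *s y) = c * B x y" "B x (y - z) = B x y - B x z"
    "B x 0 = 0"
    by (simp_all add: add scale diff)
qed

lemma add_left: "B (y + z) x = B y x + B z x"
  and scale_left: "B (c *s y) x = c * B y x"
  and diff_left: "B (y - z) x = B y x - B z x"
  and zero_left: "B 0 x = 0"
  by (simp_all add: commute[of _ x] add_right scale_right diff_right zero_right)

lemmas bilinear = add_right scale_right diff_right zero_right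
  add_left scale_left diff_left zero_left

lemma eq_zero_if_orthogonal_to_all: "(\<And>y. B x y = 0) \<Longrightarrow> x = 0"
  using nondegenerate by (simp add: nondegenerate_form_def)

lemma two_neq_zero: "(2::'a) \<noteq> 0"
  using odd_card by (rule two_neq_zero_if_odd_card)

text \<open>Polarisation: as 2 is invertible, a form vanishing on the diagonal vanishes identically,
  contrary to nondegeneracy.\<close>

lemma ex_anisotropic: "\<exists>z. B z z \<noteq> 0"
proof (rule ccontr)
  assume "\<not> ?thesis"
  then have iso: "B x x = 0" for x by blast
  have "B (x + y) (x + y) = B x x + B y y + 2 * B x y" for x y
    by (simp add: bilinear commute[of y x])
  then have zero: "B x y = 0" for x y using two_neq_zero by (simp add: iso)
  have "axis i (1::'a) = (0::'a ^ 'n)" for i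
    by (rule eq_zero_if_orthogonal_to_all) (rule zero)
  then show False by (simp add: axis_eq_0_iff)
qed

text \<open>Otherwise orthogonalisation in \<open>S\<close> yields three orthogonal anisotropic
  vectors, and a diagonal ternary form has a zero with last coordinate 1. The form may be degenerate
  on \<open>S\<close>.\<close>

lemma ex_isotropic_in_subspace:
  assumes S: "vec.subspace S" "vec.dim S \<ge> 3"
  shows "\<exists>v\<in>S. v \<noteq> 0 \<and> B v v = 0"
proof (rule ccontr)
  assume "\<not> ?thesis"
  then have aniso: "B v v \<noteq> 0" if "v \<in> S" "v \<noteq> 0" for v using that by blast
  obtain e1 where e1: "e1 \<in> S" "e1 \<noteq> 0"
    using S(2) ex_nonzero_if_dim_pos[of S] by auto
  define S1 where "S1 = S \<inter> {x. B e1 x = 0}"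
  have S1: "vec.subspace S1" "vec.dim S1 \<ge> 2"
    using dim_Int_kernel[OF linear S(1), of e1] S(2) by (simp_all add: S1_def)
  obtain e2 where e2: "e2 \<in> S1" "e2 \<noteq> 0"
    using S1(2) ex_nonzero_if_dim_pos[of S1] by auto
  define S2 where "S2 = S1 \<inter> {x. B e2 x = 0}"
  have "vec.dim S2 > 0"
    using dim_Int_kernel(2)[OF linear S1(1), of e2] S1(2) by (simp add: S2_def)
  then obtain e3 where e3: "e3 \<in> S2" "e3 \<noteq> 0"
    using ex_nonzero_if_dim_pos[of S2] by auto
  have orth: "B e1 e2 = 0" "B e1 e3 = 0" "B e2 e3 = 0"
    "B e2 e1 = 0" "B e3 e1 = 0" "B e3 e2 = 0"
    using e2 e3 commute[of e2 e1] commute[of e3 e1] commute[of e3 e2]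
    by (auto simp: S1_def S2_def)
  have in_S: "e2 \<in> S" "e3 \<in> S" using e2 e3 by (auto simp: S1_def S2_def)
  obtain x y where xy: "B e1 e1 * x\<^sup>2 + B e2 e2 * y\<^sup>2 + B e3 e3 = 0"
    using ex_scaled_squares_add_eq_zero[OF odd_card] aniso e1 e2 in_S by metis
  define w where "w = x *s e1 + y *s e2 + e3"
  have "B w w = 0"
    using xy by (simp add: w_def bilinear orth power2_eq_square algebra_simps)
  moreover have "w \<in> S"
    unfolding w_def using e1 in_S S(1) by (intro vec.subspace_add vec.subspace_scale)
  \<comment> \<open>The coefficient 1 of \<open>e3\<close> is what keeps \<open>w\<close> from being
    zero.\<close>
  moreover have "B w e3 \<noteq> 0" using aniso[OF in_S(2) e3(2)] by (simp add: w_def bilinear orth)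
  then have "w \<noteq> 0" by (auto simp: bilinear)
  ultimately show False using aniso by blast
qed

section \<open>The isometry group and its subgroup of scalars\<close>

lemma mem_GO: "g \<in> carrier (GO B) \<longleftrightarrow>
    Vector_Spaces.linear (*s) (*s) g \<and> bij g \<and> (\<forall>x y. B (g x) (g y) = B x y)"
  by (simp add: GO_def)

lemma mult_GO [simp]: "g \<otimes>\<^bsub>GO B\<^esub> h = g \<circ> h" and one_GO [simp]: "\<one>\<^bsub>GO B\<^esub> = id"
  by (simp_all add: GO_def)

text \<open>Nondegeneracy gives injectivity, and finite dimension then gives bijectivity.\<close>

lemma linear_isometry_in_GO:
  assumes g: "Vector_Spaces.linear (*s) (*s) g" and iso: "\<And>x y. B (g x) (g y) = B x y"
  shows "g \<in> carrier (GO B)"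
proof -
  interpret g: Vector_Spaces.linear "(*s)" "(*s)" g by fact
  have "x = 0" if "g x = 0" for x
    by (rule eq_zero_if_orthogonal_to_all) (metis iso that zero_left)
  then have "inj g" using g.inj_iff_eq_0 by blast
  then have "bij g" using vec.linear_inj_imp_surj[OF g] by (simp add: bij_def)
  then show ?thesis using g iso by (simp add: mem_GO)
qed

lemma group_GO: "group (GO B)"
proof (rule groupI)
  show "\<one>\<^bsub>GO B\<^esub> \<in> carrier (GO B)"
    by (simp add: mem_GO Vector_Spaces.linear_iff vec.vector_space_axioms)
next
  fix g h assume "g \<in> carrier (GO B)" "h \<in> carrier (GO B)"
  then show "g \<otimes>\<^bsub>GO B\<^esub> h \<in> carrier (GO B)"
    by (auto simp: mem_GO Vector_Spaces.linear_iff bij_comp)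
next
  fix g assume g: "g \<in> carrier (GO B)"
  then have bij: "bij g" by (simp add: mem_GO)
  define g' where "g' = inv_into UNIV g"
  have gg: "g (g' x) = x" for x
    using bij by (simp add: g'_def bij_is_surj surj_f_inv_f)
  have lin: "g (x + y) = g x + g y" "g (c *s x) = c *s g x" for x y c
    using g by (auto simp: mem_GO Vector_Spaces.linear_iff)
  have "g' \<in> carrier (GO B)"
  proof (rule linear_isometry_in_GO)
    show "Vector_Spaces.linear (*s) (*s) g'"
      unfolding Vector_Spaces.linear_iff
    proof (intro conjI allI vec.vector_space_axioms)
      show "g' (x + y) = g' x + g' y" for x y
        by (rule injD[OF bij_is_inj[OF bij]]) (simp add: lin gg)
      show "g' (c *s x) = c *s g' x" for c x
        by (rule injD[OF bij_is_inj[OF bij]]) (simp add: lin gg)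
    qed
    show "B (g' x) (g' y) = B x y" for x y
      using g gg by (metis mem_GO)
  qed
  moreover have "g' \<circ> g = id" using bij by (simp add: g'_def bij_is_inj)
  ultimately show "\<exists>y\<in>carrier (GO B). y \<otimes>\<^bsub>GO B\<^esub> g = \<one>\<^bsub>GO B\<^esub>" by auto
qed (simp_all add: comp_assoc)

sublocale GO: group "GO B" by (rule group_GO)

lemma scalar_GO_commute:
  assumes "g \<in> carrier (GO B)"
  shows "g \<circ> (*s) c = (*s) c \<circ> g"
  using assms by (auto simp: mem_GO Vector_Spaces.linear_iff)

text \<open>Scalars commute with every linear map, so conjugation fixes them.\<close>

lemma normal_GO_scalars: "GO_scalars B \<lhd> GO B"
  unfolding GO.normal_inv_iff
proof (intro conjI ballI)
  show "subgroup (GO_scalars B) (GO B)"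
  proof (rule GO.subgroupI)
    show "GO_scalars B \<subseteq> carrier (GO B)" by (auto simp: GO_scalars_def)
    have "id \<in> GO_scalars B"
      using GO.one_closed by (auto simp: GO_scalars_def image_iff intro!: exI[of _ 1])
    then show "GO_scalars B \<noteq> {}" by blast
  next
    fix s assume "s \<in> GO_scalars B"
    then obtain c where s: "s \<in> carrier (GO B)" "s = (*s) c" by (auto simp: GO_scalars_def)
    have "s \<circ> inv\<^bsub>GO B\<^esub> s = id" using GO.r_inv[OF s(1)] by simp
    then have eq: "c *s (inv\<^bsub>GO B\<^esub> s) x = x" for x unfolding s(2) by (metis comp_apply id_apply)
    \<comment> \<open>A nonzero test vector excludes \<open>c = 0\<close>, after which the inverse
      is multiplication by \<open>1 / c\<close>.\<close>
    have "c \<noteq> 0" using eq[of "axis undefined 1"] by (auto simp: axis_eq_0_iff)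
    then have "(inv\<^bsub>GO B\<^esub> s) x = (1 / c) *s x" for x
      by (subst eq[of x, symmetric]) simp
    then have "inv\<^bsub>GO B\<^esub> s \<in> range (*s)" by blast
    then show "inv\<^bsub>GO B\<^esub> s \<in> GO_scalars B" using s by (simp add: GO_scalars_def)
  next
    fix s s' assume "s \<in> GO_scalars B" "s' \<in> GO_scalars B"
    then obtain c c' where "s \<in> carrier (GO B)" "s' \<in> carrier (GO B)" "s = (*s) c" "s' = (*s) c'"
      by (auto simp: GO_scalars_def)
    moreover from this have "s \<circ> s' = (*s) (c * c')" by (auto simp: fun_eq_iff)
    ultimately show "s \<otimes>\<^bsub>GO B\<^esub> s' \<in> GO_scalars B"
      using GO.m_closed[of s s'] by (auto simp: GO_scalars_def)
  qed
next
  fix g s assume g: "g \<in> carrier (GO B)" and s: "s \<in> GO_scalars B"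
  then obtain c where c: "s \<in> carrier (GO B)" "s = (*s) c" by (auto simp: GO_scalars_def)
  have "g \<otimes>\<^bsub>GO B\<^esub> s = s \<otimes>\<^bsub>GO B\<^esub> g" using scalar_GO_commute[OF g] c(2) by simp
  then have "g \<otimes>\<^bsub>GO B\<^esub> s \<otimes>\<^bsub>GO B\<^esub> inv\<^bsub>GO B\<^esub> g = s"
    using g c(1) GO.inv_solve_right' GO.m_closed by metis
  then show "g \<otimes>\<^bsub>GO B\<^esub> s \<otimes>\<^bsub>GO B\<^esub> inv\<^bsub>GO B\<^esub> g \<in> GO_scalars B" using s by simp
qed

section \<open>The quotient map onto the projective group\<close>

abbreviation proj :: "('a ^ 'n \<Rightarrow> 'a ^ 'n) \<Rightarrow> ('a ^ 'n \<Rightarrow> 'a ^ 'n) set" where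
  "proj g \<equiv> GO_scalars B #>\<^bsub>GO B\<^esub> g"

sublocale PGO: group "PGO B"
  unfolding PGO_def by (rule normal.factorgroup_is_group[OF normal_GO_scalars])

sublocale proj: group_hom "GO B" "PGO B" proj
  by (intro group_hom.intro group_hom_axioms.intro group_GO PGO.group_axioms)
    (simp add: PGO_def normal.r_coset_hom_Mod[OF normal_GO_scalars])

lemma carrier_PGO: "carrier (PGO B) = proj ` carrier (GO B)"
  by (auto simp: PGO_def FactGroup_def RCOSETS_def)

lemma proj_eq_one_iff:
  assumes "g \<in> carrier (GO B)"
  shows "proj g = \<one>\<^bsub>PGO B\<^esub> \<longleftrightarrow> (\<exists>c. g = (*s) c)"
proof -
  have sub: "subgroup (GO_scalars B) (GO B)"
    by (rule normal_imp_subgroup[OF normal_GO_scalars])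
  have "proj g = \<one>\<^bsub>PGO B\<^esub> \<longleftrightarrow> g \<in> GO_scalars B"
    using GO.coset_join1[OF _ assms sub] GO.coset_join2[OF assms sub] subgroup.subset[OF sub]
    by (auto simp: PGO_def FactGroup_def)
  then show ?thesis using assms by (auto simp: GO_scalars_def)
qed

section \<open>Long root elements and reflections\<close>

text \<open>A Siegel transformation. The added term is bilinear and alternating in \<open>u\<close>
  and \<open>v\<close>, so it depends only on their bivector.\<close>

definition long_root :: "'a ^ 'n \<Rightarrow> 'a ^ 'n \<Rightarrow> 'a ^ 'n \<Rightarrow> 'a ^ 'n" where
  "long_root u v x = x + B x u *s v - B x v *s u"

definition reflection :: "'a ^ 'n \<Rightarrow> 'a ^ 'n \<Rightarrow> 'a ^ 'n" where
  "reflection z x = x - (2 * B x z / B z z) *s z"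

text \<open>Write the map as \<open>1 + A\<close>. Then \<open>A\<close> is skew for
  \<open>B\<close>, which cancels the mixed terms, and its image lies in the totally singular span
  of \<open>u\<close> and \<open>v\<close>, so \<open>B (A x) (A y) = 0\<close>.\<close>

lemma long_root_in_GO:
  assumes "B u u = 0" "B u v = 0" "B v v = 0"
  shows "long_root u v \<in> carrier (GO B)"
proof (rule linear_isometry_in_GO)
  show "Vector_Spaces.linear (*s) (*s) (long_root u v)"
    unfolding Vector_Spaces.linear_iff
    by (auto simp: vec.vector_space_axioms long_root_def bilinear vec_eq_iff algebra_simps)
  show "B (long_root u v x) (long_root u v y) = B x y" for x y
    using assms
    by (simp add: long_root_def bilinear commute[of v u] commute[of u y] commute[of v y]
        algebra_simps)
qed

lemma reflection_in_GO:
  assumes "B z z \<noteq> 0"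
  shows "reflection z \<in> carrier (GO B)"
proof (rule linear_isometry_in_GO)
  show "Vector_Spaces.linear (*s) (*s) (reflection z)"
    unfolding Vector_Spaces.linear_iff
    by (auto simp: vec.vector_space_axioms reflection_def bilinear vec_eq_iff algebra_simps
        add_divide_distrib)
  show "B (reflection z x) (reflection z y) = B x y" for x y
    using assms
    by (simp add: reflection_def bilinear commute[of z y] field_simps)
qed

lemma comp_long_root:
  assumes "g \<in> carrier (GO B)"
  shows "g \<circ> long_root u v = long_root (g u) (g v) \<circ> g"
proof -
  interpret g: Vector_Spaces.linear "(*s)" "(*s)" g using assms by (simp add: mem_GO)
  show ?thesis
    using assms by (auto simp: mem_GO long_root_def g.add g.diff g.scale)
qed

lemma conj_long_root:
  assumes "g \<in> carrier (GO B)" "B u u = 0" "B u v = 0" "B v v = 0"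
  shows "g \<otimes>\<^bsub>GO B\<^esub> long_root u v \<otimes>\<^bsub>GO B\<^esub> inv\<^bsub>GO B\<^esub> g = long_root (g u) (g v)"
proof -
  have "long_root (g u) (g v) \<in> carrier (GO B)"
    using assms by (intro long_root_in_GO) (auto simp: mem_GO)
  moreover have "g \<otimes>\<^bsub>GO B\<^esub> long_root u v = long_root (g u) (g v) \<otimes>\<^bsub>GO B\<^esub> g"
    using comp_long_root[OF assms(1)] by simp
  ultimately show ?thesis
    using assms(1) long_root_in_GO[OF assms(2-4)] GO.inv_solve_right' GO.m_closed by metis
qed

text \<open>With \<open>A = t - 1\<close> and \<open>A'\<close> its conjugate, \<open>A A'\<close> and \<open>A' A\<close> both equal
  \<open>x \<mapsto> c B(x,w)w\<close> for \<open>w = B(v,z)u - B(u,z)v\<close>, a vector of both planes.\<close>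

lemma long_root_reflection_commute:
  fixes z
  assumes tot: "B u u = 0" "B u v = 0" "B v v = 0"
  defines "u' \<equiv> reflection z u" and "v' \<equiv> reflection z v"
  shows "long_root u v \<circ> long_root u' v' = long_root u' v' \<circ> long_root u v"
proof
  fix x
  define c where "c = 2 / B z z"
  define w where "w = B v z *s u - B u z *s v"
  have u': "u' = u - (c * B u z) *s z" and v': "v' = v - (c * B v z) *s z"
    by (simp_all add: u'_def v'_def reflection_def c_def)
  let ?r = "x + (B x u *s v - B x v *s u) + (B x u' *s v' - B x v' *s u') + (c * B x w) *s w"
  have tot': "B v u = 0" using tot commute by simp
  have "long_root u v (long_root u' v' x) = ?r"
    by (simp add: long_root_def u' v' w_def bilinear tot tot' commute[of z u] commute[of z v]
        vec_eq_iff algebra_simps)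
  moreover have "long_root u' v' (long_root u v x) = ?r"
    by (simp add: long_root_def u' v' w_def bilinear tot tot' commute[of z u] commute[of z v]
        vec_eq_iff algebra_simps)
  ultimately show "(long_root u v \<circ> long_root u' v') x = (long_root u' v' \<circ> long_root u v) x"
    by simp
qed

text \<open>The vector \<open>u\<close> is fixed, so the scalar would be 1. Then
  \<open>B x u *s v = B x v *s u\<close> for all \<open>x\<close>, and independence puts
  \<open>u\<close> in the radical.\<close>

lemma long_root_not_scalar:
  assumes tot: "B u u = 0" "B u v = 0" and indep: "u \<noteq> 0" "v \<notin> vec.span {u}"
  shows "long_root u v \<noteq> (*s) c"
proof
  assume *: "long_root u v = (*s) c"
  have "c *s u = u" using fun_cong[OF *, of u] by (simp add: long_root_def tot)
  then have "c = 1" using indep(1) by (metis vec.scale_cancel_right vec.scale_one)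
  then have eq: "B x u *s v = B x v *s u" for x
    using fun_cong[OF *, of x] by (simp add: long_root_def algebra_simps)
  have "B u x = 0" for x
  proof (rule ccontr)
    assume "B u x \<noteq> 0"
    then have "v = (B x v / B x u) *s u"
      using arg_cong[OF eq[of x], of "(*s) (1 / B x u)"] commute[of u x] by simp
    then show False using indep(2) by (metis vec.span_base vec.span_scale singletonI)
  qed
  then show False using indep(1) eq_zero_if_orthogonal_to_all by blast
qed

text \<open>In dimension at least two some nonzero \<open>y\<close> is orthogonal to
  \<open>z\<close>; it is fixed, while \<open>z\<close> is negated.\<close>

lemma reflection_not_scalar:
  assumes "B z z \<noteq> 0" and n: "CARD('n) \<ge> 2"
  shows "reflection z \<noteq> (*s) c"
proof
  assume *: "reflection z = (*s) c"
  have "vec.dim (UNIV \<inter> {x. B z x = 0}) > 0"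
    using dim_Int_kernel(2)[OF linear vec.subspace_UNIV, of z] n
    by (simp only: vec_dim_card)
  then obtain y where y: "B z y = 0" "y \<noteq> 0" using ex_nonzero_if_dim_pos by blast
  have "c *s y = y" using fun_cong[OF *, of y] y commute[of y z] by (simp add: reflection_def)
  then have "c = 1" using y(2) by (metis vec.scale_cancel_right vec.scale_one)
  then have "2 *s z = 0" using fun_cong[OF *, of z] assms(1) by (simp add: reflection_def)
  then have "z = 0" using two_neq_zero by simp
  then show False using assms(1) by (simp add: bilinear)
qed

lemma mixed_identity_if_singular_plane:
  assumes tot: "B u u = 0" "B u v = 0" "B v v = 0" and indep: "u \<noteq> 0" "v \<notin> vec.span {u}"
    and n: "CARD('n) \<ge> 2"
  shows "\<exists>w. mixed_identity (PGO B) 1 w \<and> word_length w = 8"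
proof -
  obtain z where z: "B z z \<noteq> 0" using ex_anisotropic by blast
  define t h where "t = long_root u v" and "h = reflection z"
  have t: "t \<in> carrier (GO B)" unfolding t_def using tot by (rule long_root_in_GO)
  have h: "h \<in> carrier (GO B)" unfolding h_def using z by (rule reflection_in_GO)
  have "mixed_identity (PGO B) 1 (conj_comm_word (PGO B) (proj t) (proj h))"
  proof (rule PGO.mixed_identity_conj_comm_word)
    show "proj t \<in> carrier (PGO B)" "proj h \<in> carrier (PGO B)" using t h by auto
    show "proj t \<noteq> \<one>\<^bsub>PGO B\<^esub>"
      using long_root_not_scalar[OF tot(1,2) indep] proj_eq_one_iff[OF t] by (auto simp: t_def)
    show "proj h \<noteq> \<one>\<^bsub>PGO B\<^esub>"
      using reflection_not_scalar[OF z n] proj_eq_one_iff[OF h] by (auto simp: h_def)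
    fix x assume "x \<in> carrier (PGO B)"
    then obtain g where g: "g \<in> carrier (GO B)" "x = proj g" by (auto simp: carrier_PGO)
    \<comment> \<open>The images \<open>g u\<close> and \<open>g v\<close> again span a totally
      singular plane, so one fixed reflection \<open>h\<close> serves every conjugate of
      \<open>t\<close>.\<close>
    define y where "y = long_root (g u) (g v)"
    have tot': "B (g u) (g u) = 0" "B (g u) (g v) = 0" "B (g v) (g v) = 0"
      using g(1) tot by (auto simp: mem_GO)
    have y: "y \<in> carrier (GO B)" unfolding y_def using tot' by (rule long_root_in_GO)
    have "g \<otimes>\<^bsub>GO B\<^esub> t \<otimes>\<^bsub>GO B\<^esub> inv\<^bsub>GO B\<^esub> g = y"
      unfolding t_def y_def using g(1) tot by (rule conj_long_root)
    then have xt: "x \<otimes>\<^bsub>PGO B\<^esub> proj t \<otimes>\<^bsub>PGO B\<^esub> inv\<^bsub>PGO B\<^esub> x = proj y"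
      using g t by (metis GO.inv_closed GO.m_closed proj.hom_inv proj.hom_mult)
    define y' where "y' = h \<otimes>\<^bsub>GO B\<^esub> y \<otimes>\<^bsub>GO B\<^esub> inv\<^bsub>GO B\<^esub> h"
    have y': "y' \<in> carrier (GO B)" unfolding y'_def using h y by blast
    have y'_eq: "y' = long_root (h (g u)) (h (g v))"
      unfolding y'_def y_def using h tot' by (rule conj_long_root)
    have hy: "proj h \<otimes>\<^bsub>PGO B\<^esub> proj y \<otimes>\<^bsub>PGO B\<^esub> inv\<^bsub>PGO B\<^esub> (proj h) = proj y'"
      unfolding y'_def using h y by (metis GO.inv_closed GO.m_closed proj.hom_inv proj.hom_mult)
    have "y \<otimes>\<^bsub>GO B\<^esub> y' = y' \<otimes>\<^bsub>GO B\<^esub> y"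
      using long_root_reflection_commute[OF tot'] by (simp add: y_def y'_eq h_def)
    then have "proj y \<otimes>\<^bsub>PGO B\<^esub> proj y' = proj y' \<otimes>\<^bsub>PGO B\<^esub> proj y"
      using y y' by (metis proj.hom_mult)
    then show "x \<otimes>\<^bsub>PGO B\<^esub> proj t \<otimes>\<^bsub>PGO B\<^esub> inv\<^bsub>PGO B\<^esub> x \<otimes>\<^bsub>PGO B\<^esub>
        (proj h \<otimes>\<^bsub>PGO B\<^esub> (x \<otimes>\<^bsub>PGO B\<^esub> proj t \<otimes>\<^bsub>PGO B\<^esub> inv\<^bsub>PGO B\<^esub> x) \<otimes>\<^bsub>PGO B\<^esub> inv\<^bsub>PGO B\<^esub> (proj h)) =
        proj h \<otimes>\<^bsub>PGO B\<^esub> (x \<otimes>\<^bsub>PGO B\<^esub> proj t \<otimes>\<^bsub>PGO B\<^esub> inv\<^bsub>PGO B\<^esub> x) \<otimes>\<^bsub>PGO B\<^esub> inv\<^bsub>PGO B\<^esub> (proj h) \<otimes>\<^bsub>PGO B\<^esub>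
        (x \<otimes>\<^bsub>PGO B\<^esub> proj t \<otimes>\<^bsub>PGO B\<^esub> inv\<^bsub>PGO B\<^esub> x)"
      unfolding xt hy .
  qed
  moreover have "word_length (conj_comm_word (PGO B) (proj t) (proj h)) = 8"
    by (simp add: word_length_def conj_comm_word_def)
  ultimately show ?thesis by blast
qed

section \<open>Existence of a totally singular plane\<close>

text \<open>Take \<open>u\<close> isotropic and \<open>w\<close> not orthogonal to it. The vectors
  orthogonal to both form a space of dimension at least 3, hence contain an isotropic
  \<open>v\<close>; orthogonality to \<open>w\<close> keeps \<open>v\<close> off the line of
  \<open>u\<close>.\<close>

lemma ex_singular_plane_if_dim_ge_5:
  assumes "CARD('n) \<ge> 5"
  shows "\<exists>u v. B u u = 0 \<and> B u v = 0 \<and> B v v = 0 \<and> u \<noteq> 0 \<and> v \<notin> vec.span {u}"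
proof -
  have dim: "vec.dim (UNIV :: ('a ^ 'n) set) \<ge> 5" using assms by (simp only: vec_dim_card)
  then obtain u where u: "u \<noteq> 0" "B u u = 0"
    using ex_isotropic_in_subspace[OF vec.subspace_UNIV] by auto
  then obtain w where w: "B u w \<noteq> 0" using eq_zero_if_orthogonal_to_all by blast
  define S1 where "S1 = UNIV \<inter> {x. B u x = 0}"
  have S1: "vec.subspace S1" "vec.dim S1 \<ge> 4"
    using dim_Int_kernel[OF linear vec.subspace_UNIV, of u] dim unfolding S1_def by linarith+
  define S where "S = S1 \<inter> {x. B w x = 0}"
  have S: "vec.subspace S" "vec.dim S \<ge> 3"
    using dim_Int_kernel[OF linear S1(1), of w] S1 unfolding S_def by linarith+
  obtain v where v: "v \<in> S" "v \<noteq> 0" "B v v = 0"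
    using ex_isotropic_in_subspace[OF S] by blast
  have "v \<notin> vec.span {u}"
  proof
    assume "v \<in> vec.span {u}"
    then obtain k where "v = k *s u" by (auto simp: vec.span_singleton)
    moreover have "B w v = 0" using v(1) by (simp add: S_def)
    ultimately show False using v(2) w commute[of w u] by (simp add: bilinear)
  qed
  moreover have "B u v = 0" using v(1) by (simp add: S_def S1_def)
  ultimately show ?thesis using u v by blast
qed

text \<open>An isotropic vector shows that the Witt index is positive, so here it is at least 2, and
  a subspace attaining it contains the plane.\<close>

lemma ex_singular_plane_if_witt_index_neq_1:
  assumes "CARD('n) \<ge> 3" "witt_index B \<noteq> 1"
  shows "\<exists>u v. B u u = 0 \<and> B u v = 0 \<and> B v v = 0 \<and> u \<noteq> 0 \<and> v \<notin> vec.span {u}"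
proof -
  let ?D = "{vec.dim W |W. totally_singular B W}"
  \<comment> \<open>Finiteness makes \<open>Max\<close> in \<open>witt_index\<close> a genuine,
    attained maximum.\<close>
  have fin: "finite ?D"
    by (rule finite_subset[of _ "{..CARD('n)}"]) (auto simp: dim_subset_UNIV_cart_gen)
  have "vec.dim (UNIV :: ('a ^ 'n) set) \<ge> 3" using assms(1) by (simp only: vec_dim_card)
  then obtain u0 where u0: "u0 \<noteq> 0" "B u0 u0 = 0"
    using ex_isotropic_in_subspace[OF vec.subspace_UNIV] by auto
  then have "totally_singular B (vec.span {u0})"
    unfolding totally_singular_def
    by (intro conjI vec.subspace_span) (auto simp: vec.span_singleton bilinear)
  moreover have "vec.dim (vec.span {u0}) = 1" using u0(1) by simp
  ultimately have one: "1 \<in> ?D" by (metis (mono_tags, lifting) mem_Collect_eq)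
  then have "witt_index B \<ge> 1" unfolding witt_index_def using fin by (rule Max_ge[rotated])
  moreover have "witt_index B \<in> ?D" unfolding witt_index_def using fin one by (intro Max_in) auto
  ultimately obtain W where W: "totally_singular B W" "vec.dim W \<ge> 2"
    using assms(2) by fastforce
  then obtain u where u: "u \<in> W" "u \<noteq> 0" using ex_nonzero_if_dim_pos[of W] by auto
  have "\<not> W \<subseteq> vec.span {u}"
    using W(2) vec.dim_subset[of W "vec.span {u}"] u(2) by auto
  then obtain v where "v \<in> W" "v \<notin> vec.span {u}" by blast
  then show ?thesis using u W(1) by (auto simp: totally_singular_def)
qed

section \<open>Dimension at most two\<close>

lemma linear_combination_image:
  assumes "g \<in> carrier (GO B)"
  shows "g (x *s e + y *s f) = x *s g e + y *s g f"
  using assms by (auto simp: mem_GO Vector_Spaces.linear_iff)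

text \<open>The value \<open>e = 0\<close> covers dimension one, giving both dimensions a common
  shape. A nonzero isotropic \<open>e\<close> orthogonal to \<open>z\<close> would lie in the
  radical.\<close>

lemma ex_orthogonal_spanning_pair:
  assumes "CARD('n) \<le> 2"
  shows "\<exists>z e. B z z \<noteq> 0 \<and> B z e = 0 \<and> (e = 0 \<or> B e e \<noteq> 0) \<and> (\<forall>v. \<exists>x y. v = x *s z + y *s e)"
proof -
  obtain z where z: "B z z \<noteq> 0" using ex_anisotropic by blast
  let ?K = "UNIV \<inter> {x. B z x = 0}"
  have K: "v - (B z v / B z z) *s z \<in> ?K" for v using z by (simp add: bilinear)
  show ?thesis
  proof (cases "?K = {0}")
    case True
    have "v - (B z v / B z z) *s z = 0" for v using K[of v] True by blast
    then have "v = (B z v / B z z) *s z + 0 *s 0" for v by simp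
    then show ?thesis using z by (intro exI[of _ z] exI[of _ 0]) (auto simp: bilinear)
  next
    case False
    then obtain e where e: "e \<in> ?K" "e \<noteq> 0" by (auto simp: bilinear)
    have ze: "z \<notin> vec.span {e}" using e z commute[of e z] by (auto simp: vec.span_singleton bilinear)
    then have ind: "vec.independent {z, e}"
      using e(2) by (intro vec.independent_insertI) (auto simp: vec.independent_insert vec.independent_empty)
    have "z \<noteq> e" using ze vec.span_base by blast
    then have "vec.dim (UNIV :: ('a ^ 'n) set) \<le> card {z, e}"
      using assms by (simp only: vec_dim_card) simp
    then have "UNIV \<subseteq> vec.span {z, e}" using ind by (intro vec.card_ge_dim_independent) auto
    then have span: "\<exists>x y. v = x *s z + y *s e" for v
      by (auto simp: vec.span_insert vec.span_singleton algebra_simps)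
    have "B e e \<noteq> 0"
    proof
      assume "B e e = 0"
      then have "B e v = 0" for v
        using span[of v] e(1) commute[of e z] by (auto simp: bilinear)
      then show False using e(2) eq_zero_if_orthogonal_to_all by blast
    qed
    then show ?thesis using z e(1) span by blast
  qed
qed

text \<open>An isometry of a plane of determinant \<open>1\<close> is a rotation, and one of determinant \<open>-1\<close> is an
  involution.\<close>

lemma involution_or_rotation:
  assumes g: "g \<in> carrier (GO B)"
    and ze: "B z z \<noteq> 0" "B z e = 0" "B e e \<noteq> 0" and span: "\<And>v. \<exists>x y. v = x *s z + y *s e"
  shows "g \<circ> g = id \<or>
    (\<exists>\<alpha> \<beta>. g z = \<alpha> *s z + \<beta> *s e \<and> g e = (- (B e e / B z z) * \<beta>) *s z + \<alpha> *s e)"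
proof -
  obtain \<alpha> \<beta> where gz: "g z = \<alpha> *s z + \<beta> *s e" using span by blast
  obtain \<gamma> \<delta> where ge: "g e = \<gamma> *s z + \<delta> *s e" using span by blast
  define a b where "a = B z z" and "b = B e e"
  have ab: "a \<noteq> 0" "b \<noteq> 0" using ze by (simp_all add: a_def b_def)
  have ez: "B e z = 0" using ze(2) commute by simp
  have iso: "B (g x) (g y) = B x y" for x y using g by (simp add: mem_GO)
  have 1: "a * \<alpha> * \<alpha> + b * \<beta> * \<beta> = a"
    using iso[of z z] by (simp add: gz bilinear ze ez a_def b_def algebra_simps)
  have 2: "a * \<gamma> * \<gamma> + b * \<delta> * \<delta> = b"
    using iso[of e e] by (simp add: ge bilinear ze ez a_def b_def algebra_simps)
  have 3: "a * \<alpha> * \<gamma> + b * \<beta> * \<delta> = 0"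
    using iso[of z e] by (simp add: gz ge bilinear ze ez a_def b_def algebra_simps)
  \<comment> \<open>\<open>D\<close> is the determinant of \<open>g\<close> with respect to
    \<open>z\<close> and \<open>e\<close>. Solving the norm and orthogonality equations
    \<open>1\<close> and \<open>3\<close> by Cramer's rule expresses the image of \<open>e\<close>
    through that of \<open>z\<close> and \<open>D\<close>.\<close>
  define D where "D = \<alpha> * \<delta> - \<beta> * \<gamma>"
  have "a * (\<alpha> * D) = (a * \<alpha> * \<alpha> + b * \<beta> * \<beta>) * \<delta> - (a * \<alpha> * \<gamma> + b * \<beta> * \<delta>) * \<beta>"
    by (simp add: D_def algebra_simps)
  also have "\<dots> = a * \<delta>" unfolding 1 3 by simp
  finally have \<delta>: "\<delta> = \<alpha> * D" using ab by simp
  have "- b * \<beta> * D = (a * \<alpha> * \<alpha> + b * \<beta> * \<beta>) * \<gamma> - (a * \<alpha> * \<gamma> + b * \<beta> * \<delta>) * \<alpha>"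
    by (simp add: D_def algebra_simps)
  also have "\<dots> = a * \<gamma>" unfolding 1 3 by simp
  finally have \<gamma>: "a * \<gamma> = - b * \<beta> * D" by simp
  \<comment> \<open>Substituting these expressions into the norm of \<open>g e\<close> forces the
    square of \<open>D\<close> to be 1.\<close>
  have "a * b = a * (a * \<gamma> * \<gamma> + b * \<delta> * \<delta>)" unfolding 2 ..
  also have "\<dots> = (a * \<gamma>) * (a * \<gamma>) + a * b * \<delta> * \<delta>" by (simp add: algebra_simps)
  also have "\<dots> = b * (a * \<alpha> * \<alpha> + b * \<beta> * \<beta>) * (D * D)"
    unfolding \<gamma> \<delta> by (simp add: algebra_simps)
  also have "\<dots> = a * b * (D * D)" unfolding 1 by simp
  finally have "D * D = 1" using ab by simp
  then consider "D = 1" | "D = - 1" by (auto simp: square_eq_1_iff)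
  then show ?thesis
  proof cases
    case 1
    then have "\<gamma> = - (b / a) * \<beta>" using \<gamma> ab by (simp add: field_simps)
    then show ?thesis using gz ge \<delta> 1 by (auto simp: a_def b_def)
  next
    case 2
    \<comment> \<open>Here the trace is 0 and the determinant -1, so by Cayley-Hamilton
      \<open>g\<close> squares to the identity.\<close>
    have \<delta>: "\<delta> = - \<alpha>" using \<delta> 2 by simp
    have \<gamma>: "\<gamma> = (b / a) * \<beta>" using \<gamma> 2 ab by (simp add: field_simps)
    have one: "\<alpha> * \<alpha> + \<beta> * \<gamma> = 1" using 1 ab unfolding \<gamma> by (simp add: field_simps)
    have ge: "g e = \<gamma> *s z + (- \<alpha>) *s e" using ge \<delta> by simp
    have "g (g z) = (\<alpha> * \<alpha> + \<beta> * \<gamma>) *s z"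
      by (simp only: gz ge linear_combination_image[OF g]) (simp add: vec_eq_iff algebra_simps)
    then have "g (g z) = z" using one by simp
    moreover have "g (g e) = (\<alpha> * \<alpha> + \<beta> * \<gamma>) *s e"
      by (simp only: gz ge linear_combination_image[OF g]) (simp add: vec_eq_iff algebra_simps)
    then have "g (g e) = e" using one by simp
    ultimately have "g (g v) = v" for v
      using span[of v] by (auto simp: linear_combination_image[OF g])
    then show ?thesis by auto
  qed
qed

text \<open>In the plane an involution has trivial square, and two rotations commute; on a line all
  maps are scalars.\<close>

lemma squares_commute_if_dim_le_2:
  assumes g: "g \<in> carrier (GO B)" and h: "h \<in> carrier (GO B)" and n: "CARD('n) \<le> 2"
  shows "g \<circ> g \<circ> (h \<circ> h) = h \<circ> h \<circ> (g \<circ> g)"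
proof -
  obtain z e where ze: "B z z \<noteq> 0" "B z e = 0" "e = 0 \<or> B e e \<noteq> 0"
    and span: "\<And>v. \<exists>x y. v = x *s z + y *s e"
    using ex_orthogonal_spanning_pair[OF n] by blast
  have comm: ?thesis if "g (h z) = h (g z)" "g (h e) = h (g e)"
  proof -
    have "g (h v) = h (g v)" for v
      using span[of v] that
      by (auto simp: linear_combination_image[OF g] linear_combination_image[OF h])
    then show ?thesis by (simp add: fun_eq_iff)
  qed
  show ?thesis
  proof (cases "e = 0")
    case True
    have zero: "g 0 = 0" "h 0 = 0"
      using linear_combination_image[OF g, of 0 0 0 0] linear_combination_image[OF h, of 0 0 0 0]
      by simp_all
    obtain x where x: "g z = x *s z" using span[of "g z"] True by auto
    obtain y where y: "h z = y *s z" using span[of "h z"] True by auto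
    show ?thesis
      using linear_combination_image[OF g, of y z 0 0] linear_combination_image[OF h, of x z 0 0]
      by (intro comm) (simp_all add: True zero x y mult.commute)
  next
    case False
    then have ee: "B e e \<noteq> 0" using ze by blast
    \<comment> \<open>Rotations have the form \<alpha> + \<beta> J with \<open>J z = e\<close> and
      \<open>J e = \<kappa> *s z\<close>, so they are polynomials in one map.\<close>
    define \<kappa> where "\<kappa> = - (B e e / B z z)"
    consider "g \<circ> g = id" | "h \<circ> h = id"
      | \<alpha> \<beta> \<alpha>' \<beta>' where
        "g z = \<alpha> *s z + \<beta> *s e" "g e = (\<kappa> * \<beta>) *s z + \<alpha> *s e"
        "h z = \<alpha>' *s z + \<beta>' *s e" "h e = (\<kappa> * \<beta>') *s z + \<alpha>' *s e"
      using involution_or_rotation[OF g ze(1,2) ee span]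
        involution_or_rotation[OF h ze(1,2) ee span] unfolding \<kappa>_def by metis
    then show ?thesis
    proof cases
      case 3
      show ?thesis
        by (rule comm)
          (simp_all add: 3 linear_combination_image[OF g] linear_combination_image[OF h]
            vec_eq_iff algebra_simps)
    qed simp_all
  qed
qed

lemma mixed_identity_if_dim_le_2:
  assumes "CARD('n) \<le> 2"
  shows "mixed_identity (PGO B) 2 (square_comm_word (PGO B))"
proof (rule PGO.mixed_identity_square_comm_word)
  fix x y assume "x \<in> carrier (PGO B)" "y \<in> carrier (PGO B)"
  then obtain g h where gh: "g \<in> carrier (GO B)" "x = proj g" "h \<in> carrier (GO B)" "y = proj h"
    by (auto simp: carrier_PGO)
  have "g \<otimes>\<^bsub>GO B\<^esub> g \<otimes>\<^bsub>GO B\<^esub> (h \<otimes>\<^bsub>GO B\<^esub> h) = h \<otimes>\<^bsub>GO B\<^esub> h \<otimes>\<^bsub>GO B\<^esub> (g \<otimes>\<^bsub>GO B\<^esub> g)"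
    using squares_commute_if_dim_le_2[OF gh(1,3) assms] by simp
  then show "x \<otimes>\<^bsub>PGO B\<^esub> x \<otimes>\<^bsub>PGO B\<^esub> (y \<otimes>\<^bsub>PGO B\<^esub> y) = y \<otimes>\<^bsub>PGO B\<^esub> y \<otimes>\<^bsub>PGO B\<^esub> (x \<otimes>\<^bsub>PGO B\<^esub> x)"
    using gh by (metis GO.m_closed proj.hom_mult)
qed

end

theorem lemmaC1:
  fixes B :: "'a::{field, finite} ^ 'n \<Rightarrow> 'a ^ 'n \<Rightarrow> 'a"
    and p q k :: nat
  assumes "prime p" and "k > 0" and "q = p ^ k" and "CARD('a) = q"
    and "p \<noteq> 2"
    and "symmetric_bilinear_form B" and "nondegenerate_form B"
    and "CARD('n) \<noteq> 3" and "\<not> (CARD('n) = 4 \<and> minus_type B)"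
  shows "\<exists>r w. mixed_identity (PGO B) r w \<and> word_length w = 8"
proof -
  have "odd p" using assms(1,5) primes_dvd_imp_eq two_is_prime_nat by blast
  then have "odd CARD('a)" using assms(3,4) by simp
  then interpret orthogonal_space B using assms(6,7) by unfold_locales
  show ?thesis
  proof (cases "CARD('n) \<le> 2")
    case True
    then have "mixed_identity (PGO B) 2 (square_comm_word (PGO B))"
      by (rule mixed_identity_if_dim_le_2)
    moreover have "word_length (square_comm_word (PGO B)) = 8"
      by (simp add: word_length_def square_comm_word_def)
    ultimately show ?thesis by blast
  next
    case False
    \<comment> \<open>In dimension four \<open>minus_type\<close> says that the Witt index is
      1.\<close>
    then have "CARD('n) \<ge> 5 \<or> CARD('n) = 4 \<and> witt_index B \<noteq> 1"
      using assms(8,9) by (auto simp: minus_type_def)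
    then have "\<exists>u v. B u u = 0 \<and> B u v = 0 \<and> B v v = 0 \<and> u \<noteq> 0 \<and> v \<notin> vec.span {u}"
      using ex_singular_plane_if_dim_ge_5 ex_singular_plane_if_witt_index_neq_1 by auto
    then show ?thesis
      using mixed_identity_if_singular_plane False by (meson nle_le)
  qed
qed

end
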